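(* Let $h,k\ge 0$ be integers, $\ell=h-k$, and let $x_0,\dots,x_k$ be arbitrary real numbers (or indeterminates). Put $y_m=\sum_{j=m}^k x_j$ for $m=0,\dots,k$. Then $$Z_{h,k}(x_0,\dots,x_k)=\sum_{0\le i_1\le\cdots\le i_\ell\le k} y_{i_1}\cdots y_{i_\ell}=h_\ell(y_0,\dots,y_k),$$ where $h_\ell$ is the complete homogeneous symmetric polynomial of degree $\ell$.
   Context: $\mathrm{St}_{h,k}$ is the set of words of length $h$ on the alphabet $\{\bullet,\circ\}$ containing exactly $k$ occurrences of $\circ$. For $B=b_1\cdots b_h\in \mathrm{St}_{h,k}$ let $E_i(B)=\#\{j<i: b_j=\circ\}$. The polynomial $Z_{h,k}$ is defined by $$Z_{h,k}(x_0,\dots,x_k)=\sum_{B\in \mathrm{St}_{h,k}}\ \prod_{\substack{i\in\{1,\dots,h\}\\ b_i=\bullet}}\left(x_{E_i(B)}+\cdots+x_k\right),$$ so it vanishes for $h<k$. By convention $h_\ell$ (and the sum above) equals $0$ for $\ell<0$ and $1$ for $\ell=0$. *)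

theory Defs
  imports Complex_Main "HOL-Library.FuncSet"
begin

datatype letter = Bullet | Circ

definition St :: "nat \<Rightarrow> nat \<Rightarrow> letter list set" where
  "St h k = {B. length B = h \<and> count_list B Circ = k}"

(* Positions are 0-based: the letter b_{i+1} of the word b_1 ... b_h is B ! i. *)
definition E :: "nat \<Rightarrow> letter list \<Rightarrow> nat" where
  "E i B = card {j. j < i \<and> B ! j = Circ}"

(* The value of the polynomial Z_{h,k} at x_0, ..., x_k; the values x j with j > k are irrelevant.
   Evaluation in an arbitrary commutative ring covers both real arguments and indeterminates. *)
definition Z :: "nat \<Rightarrow> nat \<Rightarrow> (nat \<Rightarrow> 'a::comm_ring_1) \<Rightarrow> 'a" where
  "Z h k x = (\<Sum>B\<in>St h k. \<Prod>i | i < h \<and> B ! i = Bullet. \<Sum>j = E i B..k. x j)"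

(* Sum of all monomials of total degree l in the variables y i, i in I (I finite), a monomial being
   given by its exponents a i. The degree l is an integer: for l < 0 no monomial has degree l,
   so the value is 0. *)
definition complete_homogeneous :: "int \<Rightarrow> 'i set \<Rightarrow> ('i \<Rightarrow> 'a::comm_ring_1) \<Rightarrow> 'a" where
  "complete_homogeneous l I y =
     (\<Sum>a | a \<in> (I \<rightarrow>\<^sub>E (UNIV :: nat set)) \<and> int (\<Sum>i\<in>I. a i) = l. \<Prod>i\<in>I. y i ^ a i)"

(* Sums over infinite sets are 0 by definition, so the index sets used here must be finite. *)

lemma finite_St: "finite (St h k)"
proof -
  have "(UNIV :: letter set) = {Bullet, Circ}"
    using letter.exhaust by auto
  then have "finite (UNIV :: letter set)"
    by (metis finite.emptyI finite.insertI)
  then have "finite {B :: letter list. set B \<subseteq> UNIV \<and> length B = h}"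
    by (rule finite_lists_length_eq)
  then show ?thesis
    by (rule rev_finite_subset) (auto simp: St_def)
qed

lemma finite_exponents:
  assumes "finite I"
  shows "finite {a. a \<in> (I \<rightarrow>\<^sub>E (UNIV :: nat set)) \<and> int (\<Sum>i\<in>I. a i) = l}"
proof (rule finite_subset)
  show "{a. a \<in> (I \<rightarrow>\<^sub>E (UNIV :: nat set)) \<and> int (\<Sum>i\<in>I. a i) = l} \<subseteq> I \<rightarrow>\<^sub>E {..nat l}"
  proof
    fix a assume a: "a \<in> {a. a \<in> (I \<rightarrow>\<^sub>E (UNIV :: nat set)) \<and> int (\<Sum>i\<in>I. a i) = l}"
    then have l: "nat l = (\<Sum>i\<in>I. a i)" by (metis (mono_tags, lifting) mem_Collect_eq nat_int)
    have "a i \<le> nat l" if "i \<in> I" for i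
      unfolding l using assms that by (intro member_le_sum) auto
    with a show "a \<in> I \<rightarrow>\<^sub>E {..nat l}" by (simp add: PiE_iff)
  qed
  show "finite (I \<rightarrow>\<^sub>E {..nat l})"
    using assms by (intro finite_PiE) auto
qed

lemma finite_sorted_indices:
  "finite {s. int (length s) = l \<and> sorted s \<and> set s \<subseteq> {0..k :: nat}}"
  by (rule finite_subset[OF _ finite_lists_length_eq[of "{0..k}" "nat l"]]) auto

lemma complete_homogeneous_neg: "l < 0 \<Longrightarrow> complete_homogeneous l I y = 0"
  unfolding complete_homogeneous_def
  by (rule sum.neutral) (metis (mono_tags, lifting) mem_Collect_eq not_less of_nat_0_le_iff)

lemma complete_homogeneous_0:
  assumes "finite I"
  shows "complete_homogeneous 0 I y = 1"
proof -
  have *: "{a. a \<in> (I \<rightarrow>\<^sub>E (UNIV :: nat set)) \<and> int (\<Sum>i\<in>I. a i) = 0} = {\<lambda>i\<in>I. 0}"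
    using assms by (auto simp: PiE_iff extensional_def fun_eq_iff simp flip: of_nat_sum)
  show ?thesis
    unfolding complete_homogeneous_def * by simp
qed

end

theory Submission imports Defs "HOL-Library.Multiset" begin

text \<open>
  Reading off the number of preceding \<open>\<circ>\<close> at each \<open>\<bullet>\<close> turns a word into a weakly increasing
  sequence in \<open>{0..k}\<close>, and the word is recovered by writing \<open>k\<close> copies of \<open>\<circ>\<close> and inserting the
  \<open>\<bullet>\<close>s between them. A weakly increasing sequence in turn is determined by the multiplicities of
  its entries, which are the exponents of the corresponding monomial.
\<close>

text \<open>Lists the values \<open>E i B\<close> at the bullets from left to right. Recursion on
  the first letter replaces positions: a leading \<open>Circ\<close> raises every later count by
  one, whence \<open>map Suc\<close>.\<close>

fun bullet_indices :: "letter list \<Rightarrow> nat list" where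
  "bullet_indices [] = []"
| "bullet_indices (Bullet # B) = 0 # bullet_indices B"
| "bullet_indices (Circ # B) = map Suc (bullet_indices B)"

lemma E_0 [simp]: "E 0 B = 0"
  by (simp add: E_def)

lemma E_Suc_Cons: "E (Suc i) (b # B) = (if b = Circ then Suc (E i B) else E i B)"
proof -
  have "{j. j < Suc i \<and> (b # B) ! j = Circ} =
      (if b = Circ then {0} else {}) \<union> Suc ` {j. j < i \<and> B ! j = Circ}"
    by (auto simp: less_Suc_eq_0_disj)
  then show ?thesis
    by (simp add: E_def card_image card_insert_if image_iff)
qed

lemma prod_bullets_eq_prod_list:
  fixes g :: "nat \<Rightarrow> 'a::comm_ring_1"
  shows "(\<Prod>i | i < length B \<and> B ! i = Bullet. g (E i B)) = prod_list (map g (bullet_indices B))"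
proof -
  \<comment> \<open>With the default factor 1 the product runs over all positions, so the first
    letter can be split off by shifting the index.\<close>
  have "(\<Prod>i<length B. if B ! i = Bullet then g (E i B) else 1) = prod_list (map g (bullet_indices B))"
  proof (induction B arbitrary: g rule: bullet_indices.induct)
    case (2 B)
    then show ?case
      by (simp add: prod.lessThan_Suc_shift E_Suc_Cons del: prod.lessThan_Suc cong: if_cong)
  next
    case (3 B)
    \<comment> \<open>All counts behind a leading \<open>Circ\<close> are one larger, so the
      induction hypothesis is needed for the shifted \<open>g\<close>; this is why \<open>g\<close>
      is generalised.\<close>
    from "3.IH"[of "\<lambda>i. g (Suc i)"] show ?case
      by (simp add: prod.lessThan_Suc_shift E_Suc_Cons comp_def del: prod.lessThan_Suc cong: if_cong)
  qed simp
  then show ?thesis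
    by (simp add: prod.If_cases Int_def)
qed

lemma sorted_bullet_indices: "sorted (bullet_indices B)"
  by (induction B rule: bullet_indices.induct) (auto simp: sorted_map mono_def)

lemma length_bullet_indices: "length (bullet_indices B) + count_list B Circ = length B"
  by (induction B rule: bullet_indices.induct) auto

lemma set_bullet_indices: "set (bullet_indices B) \<subseteq> {0..count_list B Circ}"
  by (induction B rule: bullet_indices.induct) auto

text \<open>A leading 0 reveals a leading \<open>Bullet\<close>. The circles behind the last bullet
  leave no trace in the list, so their number has to come from the second assumption.\<close>

lemma bullet_indices_inject:
  assumes "bullet_indices B = bullet_indices C" and "count_list B Circ = count_list C Circ"
  shows "B = C"
  using assms
proof (induction B arbitrary: C rule: bullet_indices.induct)
  case 1
  then show ?case by (cases C rule: bullet_indices.cases) auto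
next
  case (2 B)
  then show ?case by (cases C rule: bullet_indices.cases) auto
next
  case (3 B)
  then show ?case by (cases C rule: bullet_indices.cases) (auto simp: inj_map_eq_map)
qed

lemma bullet_indices_surj:
  assumes "sorted s" and "set s \<subseteq> {0..k}"
  shows "\<exists>B. bullet_indices B = s \<and> count_list B Circ = k"
  using assms
\<comment> \<open>The measure is the length of the word to be built, one letter per step.\<close>
proof (induction "k + length s" arbitrary: k s)
  case 0
  then show ?case by (auto intro: exI[of _ "[]"])
next
  case (Suc n)
  show ?case
  proof (cases "\<exists>s'. s = 0 # s'")
    case True
    then obtain s' where s: "s = 0 # s'" by blast
    with Suc.hyps(1)[of k s'] Suc.hyps(2) Suc.prems
    obtain B where "bullet_indices B = s'" "count_list B Circ = k" by auto
    with s show ?thesis by (intro exI[of _ "Bullet # B"]) simp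
  next
    case False
    \<comment> \<open>The head of a sorted list is its minimum, so if it is not 0, no entry is. The
      word must then start with \<open>Circ\<close>, and removing it lowers all entries by
      one.\<close>
    then have pos: "\<forall>i\<in>set s. i \<noteq> 0"
      using Suc.prems by (cases s) auto
    have s: "s = map Suc (map (\<lambda>i. i - 1) s)"
      using pos by (simp add: list.map_comp map_idI)
    \<comment> \<open>For \<open>k = 0\<close> all entries would be 0, so \<open>s\<close> would be
      empty, against \<open>k + length s = Suc n\<close>.\<close>
    have "k \<noteq> 0"
      using pos Suc.hyps(2) Suc.prems by (cases s) auto
    then obtain k' where k: "k = Suc k'" by (cases k) auto
    have "sorted (map (\<lambda>i. i - 1) s)"
      using Suc.prems by (auto simp: sorted_map intro: sorted_wrt_mono_rel[of s "(\<le>)"])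
    moreover have "set (map (\<lambda>i. i - 1) s) \<subseteq> {0..k'}"
      using Suc.prems k by auto
    ultimately obtain B where
      "bullet_indices B = map (\<lambda>i. i - 1) s" "count_list B Circ = k'"
      using Suc.hyps(1)[of k' "map (\<lambda>i. i - 1) s"] Suc.hyps(2) k by auto
    then have "bullet_indices (Circ # B) = s"
      using s[symmetric] by simp
    with \<open>count_list B Circ = k'\<close> k show ?thesis
      by (intro exI[of _ "Circ # B"]) simp
  qed
qed

text \<open>The integer length covers \<open>h < k\<close> without a case split: both sets are then
  empty.\<close>

lemma bij_betw_bullet_indices:
  "bij_betw bullet_indices (St h k)
     {s. int (length s) = int h - int k \<and> sorted s \<and> set s \<subseteq> {0..k}}"
proof (rule bij_betw_imageI)
  show "inj_on bullet_indices (St h k)"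
    by (auto simp: inj_on_def St_def intro: bullet_indices_inject)
  show "bullet_indices ` St h k =
      {s. int (length s) = int h - int k \<and> sorted s \<and> set s \<subseteq> {0..k}}" (is "_ = ?S")
  proof (intro equalityI subsetI)
    fix s assume "s \<in> bullet_indices ` St h k"
    then obtain B where s: "s = bullet_indices B" and B: "length B = h" "count_list B Circ = k"
      by (auto simp: St_def)
    show "s \<in> ?S"
      using length_bullet_indices[of B] set_bullet_indices[of B] sorted_bullet_indices[of B] B s
      by auto
  next
    fix s assume s: "s \<in> ?S"
    then obtain B where B: "bullet_indices B = s" "count_list B Circ = k"
      using bullet_indices_surj by blast
    with s length_bullet_indices[of B] have "B \<in> St h k"
      by (auto simp: St_def)
    with B show "s \<in> bullet_indices ` St h k" by blast
  qed
qed

lemma prod_list_map_eq_prod_count: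
  fixes y :: "'i \<Rightarrow> 'a::comm_monoid_mult"
  assumes "finite I" and "set s \<subseteq> I"
  shows "prod_list (map y s) = (\<Prod>i\<in>I. y i ^ count_list s i)"
  using assms(2)
proof (induction s)
  case (Cons b s)
  \<comment> \<open>Prepending \<open>b\<close> raises only the exponent at \<open>b\<close>; the
    extra factor is spread over \<open>I\<close> as a product with a single nontrivial factor, which
    is \<open>y b\<close> because \<open>b\<close> lies in \<open>I\<close>.\<close>
  have "(\<Prod>i\<in>I. y i ^ count_list (b # s) i)
      = (\<Prod>i\<in>I. (if i = b then y i else 1) * y i ^ count_list s i)"
    by (rule prod.cong) auto
  also have "\<dots> = y b * (\<Prod>i\<in>I. y i ^ count_list s i)"
    using assms(1) Cons.prems by (simp add: prod.distrib)
  finally show ?case using Cons by simp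
qed simp

text \<open>A sorted list is determined by its multiset, hence by its multiplicities. The
  restriction to \<open>I\<close> makes these extensional, as membership in the exponent set
  demands.\<close>

lemma bij_betw_count_list_sorted:
  fixes I :: "'i::linorder set"
  assumes "finite I"
  shows "bij_betw (\<lambda>s. restrict (count_list s) I)
           {s. int (length s) = l \<and> sorted s \<and> set s \<subseteq> I}
           {a. a \<in> (I \<rightarrow>\<^sub>E (UNIV :: nat set)) \<and> int (\<Sum>i\<in>I. a i) = l}"
    (is "bij_betw ?f ?S ?A")
proof (rule bij_betw_imageI)
  have len: "(\<Sum>i\<in>I. count_list s i) = length s" if "set s \<subseteq> I" for s
    using sum_count_set[OF that assms] .
  show "inj_on ?f ?S"
  proof (rule inj_onI)
    fix s t assume s: "s \<in> ?S" and t: "t \<in> ?S" and eq: "?f s = ?f t"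
    have "count_list s i = count_list t i" for i
    proof (cases "i \<in> I")
      case True
      with fun_cong[OF eq, of i] show ?thesis by simp
    next
      \<comment> \<open>Here \<open>?f\<close> yields no information, since both restrictions are
        \<open>undefined\<close>; the counts agree because both are 0.\<close>
      case False
      with s t have "i \<notin> set s" "i \<notin> set t" by auto
      then show ?thesis by (simp add: count_notin)
    qed
    then have "mset s = mset t"
      by (intro multiset_eqI) (simp add: count_mset)
    with s t show "s = t"
      by (metis (mono_tags, lifting) mem_Collect_eq properties_for_sort)
  qed
  show "?f ` ?S = ?A"
  proof (intro equalityI subsetI)
    fix a assume "a \<in> ?f ` ?S"
    then show "a \<in> ?A" using len by (auto simp del: of_nat_sum)
  next
    fix a assume a: "a \<in> ?A"
    define s where "s = sorted_list_of_multiset (\<Sum>i\<in>I. replicate_mset (a i) i)"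
    have mset: "mset s = (\<Sum>i\<in>I. replicate_mset (a i) i)"
      by (simp add: s_def)
    have count: "count_list s i = (if i \<in> I then a i else 0)" for i
      using assms by (simp add: mset count_sum flip: count_mset)
    have set: "set s \<subseteq> I"
    proof
      fix i assume "i \<in> set s"
      then show "i \<in> I" using count[of i] count_list_0_iff[of s i] by (auto split: if_splits)
    qed
    have "?f s = a"
      using a by (auto simp: fun_eq_iff count PiE_def extensional_def)
    moreover have "length s = (\<Sum>i\<in>I. a i)"
      unfolding len[OF set, symmetric] by (intro sum.cong) (auto simp: count)
    then have "s \<in> ?S"
      using a set by (simp add: s_def)
    ultimately show "a \<in> ?f ` ?S" by blast
  qed
qed

lemma sum_sorted_eq_complete_homogeneous:
  fixes y :: "'i::linorder \<Rightarrow> 'a::comm_ring_1"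
  assumes "finite I"
  shows "(\<Sum>s | int (length s) = l \<and> sorted s \<and> set s \<subseteq> I. prod_list (map y s))
           = complete_homogeneous l I y"
proof -
  \<comment> \<open>Inside the product over \<open>I\<close> the restriction changes nothing; it
    turns the summand into a function of the exponents, as reindexing along the bijection
    requires.\<close>
  have "(\<Sum>s | int (length s) = l \<and> sorted s \<and> set s \<subseteq> I. prod_list (map y s))
      = (\<Sum>s | int (length s) = l \<and> sorted s \<and> set s \<subseteq> I.
           \<Prod>i\<in>I. y i ^ restrict (count_list s) I i)"
    using assms by (intro sum.cong) (auto simp: prod_list_map_eq_prod_count)
  also have "\<dots> = complete_homogeneous l I y"
    unfolding complete_homogeneous_def
    by (rule sum.reindex_bij_betw[OF bij_betw_count_list_sorted[OF assms]])
  finally show ?thesis .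
qed

theorem proposition2p9:
  fixes h k :: nat and l :: int and x y :: "nat \<Rightarrow> 'a::comm_ring_1"
  assumes "l = int h - int k"
    and "\<And>m. m \<le> k \<Longrightarrow> y m = (\<Sum>j = m..k. x j)"
  shows "Z h k x = (\<Sum>s | int (length s) = l \<and> sorted s \<and> set s \<subseteq> {0..k}. prod_list (map y s))
       \<and> (\<Sum>s | int (length s) = l \<and> sorted s \<and> set s \<subseteq> {0..k}. prod_list (map y s))
           = complete_homogeneous l {0..k} y"
proof
  have "Z h k x = (\<Sum>B\<in>St h k. prod_list (map y (bullet_indices B)))"
    unfolding Z_def
  proof (rule sum.cong)
    fix B assume "B \<in> St h k"
    then have B: "length B = h" "count_list B Circ = k" by (auto simp: St_def)
    have "(\<Prod>i | i < h \<and> B ! i = Bullet. \<Sum>j = E i B..k. x j)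
        = prod_list (map (\<lambda>m. \<Sum>j = m..k. x j) (bullet_indices B))"
      using prod_bullets_eq_prod_list[of "\<lambda>m. \<Sum>j = m..k. x j" B] B by simp
    also have "\<dots> = prod_list (map y (bullet_indices B))"
    proof (intro arg_cong[of _ _ prod_list] map_cong refl)
      \<comment> \<open>\<open>y\<close> is known to be a tail sum only up to \<open>k\<close>, so
        the bound on the entries is needed.\<close>
      fix m assume "m \<in> set (bullet_indices B)"
      with set_bullet_indices[of B] B have "m \<le> k" by auto
      then show "(\<Sum>j = m..k. x j) = y m" by (simp add: assms(2))
    qed
    finally show "(\<Prod>i | i < h \<and> B ! i = Bullet. \<Sum>j = E i B..k. x j)
        = prod_list (map y (bullet_indices B))" .
  qed simp
  also have "\<dots> = (\<Sum>s | int (length s) = l \<and> sorted s \<and> set s \<subseteq> {0..k}. prod_list (map y s))"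
    unfolding assms(1) by (rule sum.reindex_bij_betw[OF bij_betw_bullet_indices])
  finally show "Z h k x =
      (\<Sum>s | int (length s) = l \<and> sorted s \<and> set s \<subseteq> {0..k}. prod_list (map y s))" .
qed (simp add: sum_sorted_eq_complete_homogeneous)

end
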